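(* Let $G$ be a 3-uniform hypergraph with $m$ edges. Then there exists a partition of the vertex set of $G$ into three parts such that each part meets at least $\frac{3}{5}m$ edges.
   Context: A 3-uniform hypergraph $G$ has a finite vertex set $V$ and a set of edges, each edge being a (distinct) 3-element subset of $V$. A set of vertices meets an edge if it has nonempty intersection with it. *)

theory Defs
  imports Complex_Main "HOL-Library.Disjoint_Sets"
begin

definition uniform_hypergraph :: "nat \<Rightarrow> 'a set \<Rightarrow> 'a set set \<Rightarrow> bool" where
  "uniform_hypergraph k V E \<longleftrightarrow> finite V \<and> (\<forall>e\<in>E. e \<subseteq> V \<and> card e = k)"

definition edges_met :: "'a set set \<Rightarrow> 'a set \<Rightarrow> 'a set set" where
  "edges_met E W = {e \<in> E. e \<inter> W \<noteq> {}}"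

text \<open>
  Parts may be empty, unlike with \<^const>\<open>partition_on\<close>: a vertex set with fewer than \<open>k\<close>
  elements has no partition into \<open>k\<close> nonempty parts.
\<close>
definition partition_into :: "nat \<Rightarrow> 'a set \<Rightarrow> (nat \<Rightarrow> 'a set) \<Rightarrow> bool" where
  "partition_into k V P \<longleftrightarrow> disjoint_family_on P {..<k} \<and> (\<Union>i<k. P i) = V"

end

theory Submission
  imports Defs
begin

text \<open>
  Call a vertex set good if it misses at most \<open>2m/5\<close> edges. If a single vertex is good, a maximum
  cut of the remaining vertices gives the other two parts. Otherwise take a partition that minimises
  the total number of missed edges. Moving one vertex gains nothing, and summing these local
  inequalities shows that at most one part is bad, say \<open>C\<close>. Shrink the other two parts to
  inclusion-minimal good sets \<open>A\<close> and \<open>B\<close>, giving the removed vertices to \<open>C\<close>: the local inequalities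
  for moves into \<open>C\<close> survive this, and minimality adds that deleting any vertex of \<open>A\<close> or \<open>B\<close> makes
  it bad. If \<open>A\<close> and \<open>B\<close> have at least three elements, averaging the two kinds of inequalities with
  weights \<open>2/3\<close> and \<open>1/3\<close> shows that \<open>C\<close> is good. If \<open>A\<close> is a pair, then edges containing \<open>A\<close> and
  one vertex of \<open>B\<close> number at most \<open>|B|\<close>, since edges are distinct. This leaves only a situation
  (with \<open>m\<close> equal to 9 or 12) in which both vertices of \<open>A\<close> miss just one edge too many, and some edge
  avoiding \<open>A\<close> has two vertices in \<open>C\<close>, one of which can be added to each vertex of \<open>A\<close>.
\<close>

section \<open>Integer arithmetic for the edge counts\<close>

lemma sum_eq_three_cases:
  fixes i j k :: nat
  assumes "i + j + k = 3"
  shows "i = 3 \<and> j = 0 \<and> k = 0 \<or> i = 2 \<and> j = 1 \<and> k = 0 \<or> i = 2 \<and> j = 0 \<and> k = 1 \<or>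
    i = 1 \<and> j = 2 \<and> k = 0 \<or> i = 1 \<and> j = 1 \<and> k = 1 \<or> i = 1 \<and> j = 0 \<and> k = 2 \<or>
    i = 0 \<and> j = 3 \<and> k = 0 \<or> i = 0 \<and> j = 2 \<and> k = 1 \<or> i = 0 \<and> j = 1 \<and> k = 2 \<or>
    i = 0 \<and> j = 0 \<and> k = 3"
  using assms by presburger

text \<open>
  The variables count edges by their intersection with parts \<open>A, B, C\<close> where \<open>|A| = 2\<close> and \<open>|B| = l\<close>:
  \<open>p = AAB\<close>, \<open>q = ABB\<close>, \<open>t = BBB\<close>, \<open>M = ABC\<close>, \<open>r1 = ACC\<close>, \<open>r2 = BCC\<close>, \<open>a2 = AAC\<close>, \<open>b2 = BBC\<close>,
  \<open>R = CCC\<close>. A part is bad if it misses at least \<open>h = \<lfloor>2m/5\<rfloor> + 1\<close> edges.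
\<close>
lemma minimal_pair_arith:
  fixes p q t M r1 r2 a2 b2 R l h m :: int
  assumes nn: "p \<ge> 0" "q \<ge> 0" "t \<ge> 0" "M \<ge> 0" "r1 \<ge> 0" "r2 \<ge> 0" "a2 \<ge> 0" "b2 \<ge> 0" "R \<ge> 0"
    and total: "m = p + q + t + M + r1 + r2 + a2 + b2 + R"
    and h: "5 * h \<ge> 2 * m + 1" "5 * h \<le> 2 * m + 5"
    and E: "p + q + t \<ge> h"
    and a1: "M + r1 \<ge> 2 * p"
    and a2: "M + q + r1 + 2 * t + 2 * b2 + 2 * r2 + 2 * R \<ge> 2 * h"
    and b1: "M + r2 \<ge> 3 * t + 2 * q"
    and good: "a2 + r1 + R + 1 \<le> h"
    and b2: "M + p + r2 \<ge> l * (h - (a2 + r1 + R))"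
    and l: "2 \<le> l" "p \<le> l"
    and l2: "l = 2 \<Longrightarrow> q \<le> 2 \<and> t = 0"
  shows "M + q + r1 + 2 * t + 2 * b2 + 2 * r2 + 2 * R = 2 * h \<and> r2 + R \<ge> 1"
proof -
  \<comment> \<open>The slack of \<open>B\<close>: it misses \<open>a2 + r1 + R\<close> edges, and
    \<open>\<beta>\<close> more would make it bad.\<close>
  define \<beta> where "\<beta> = h - (a2 + r1 + R)"
  have \<beta>: "\<beta> \<ge> 1" using good by (simp add: \<beta>_def)
  have eq: "M + r2 = m - p - q - t - h + \<beta> - b2"
    using total by (simp add: \<beta>_def)
  \<comment> \<open>\<open>b2\<close> contains the product \<open>l * \<beta>\<close>. As
    \<open>\<beta>\<close> is positive, \<open>l\<close> may be lowered to a constant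
    \<open>k\<close>, which leaves a linear inequality.\<close>
  have lin: "k * \<beta> \<le> M + r2 + p" if "k \<le> l" for k
  proof -
    have "k * \<beta> \<le> l * \<beta>" using that \<beta> by (intro mult_right_mono) auto
    then show ?thesis using b2 by (simp add: \<beta>_def)
  qed
  have up: "4 * p + q + 2 * a2 \<le> 2 * m - 2 * h" using total a1 a2 by linarith
  \<comment> \<open>Together with \<open>p \<le> l\<close> this gives
    \<open>m \<le> 5 * l - 2\<close>, so each small \<open>l\<close> leaves finitely many
    \<open>m\<close>.\<close>
  have lo: "5 * p \<ge> m + 2" if "l \<ge> 3"
    using lin[OF that] eq b1 E h(1) nn by linarith
  consider "l = 2" | "l = 3" | "l = 4" | "l = 5" | "l = 6" | "l = 7" | "l \<ge> 8" using l by linarith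
  then show ?thesis
  proof cases
    case 1
    have bd: "p \<le> 2" "q \<le> 2" "t = 0" "2 * \<beta> \<le> M + r2 + p"
      using l2[OF 1] l 1 lin[of 2] by auto
    \<comment> \<open>The mirror image of \<open>up\<close>: both sets are pairs here, so
      \<open>A\<close> and \<open>B\<close> can exchange roles.\<close>
    have down: "4 * q + p + 2 * b2 \<le> 2 * m - 2 * h"
      using bd(3,4) eq b1 by linarith
    have "h \<le> 4" using E bd by linarith
    moreover have "h \<ge> 1" using h(1) total nn by linarith
    ultimately have "h = 1 \<and> m \<le> 2 \<or> h = 2 \<and> m \<le> 4 \<or> h = 3 \<and> m \<le> 7 \<or> h = 4 \<and> m \<le> 9"
      using h(1) by presburger
    then consider "h = 1" "m \<le> 2" | "h = 2" "m \<le> 4" | "h = 3" "m \<le> 7" | "h = 4" "m \<le> 9"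
      by blast
    then have "p = 2 \<and> q = 2 \<and> m = 9 \<and> h = 4"
    proof cases
      case 1
      then show ?thesis using up down E bd nn by linarith
    next
      case 2
      then show ?thesis using up down E bd nn by linarith
    next
      case 3
      then have "p + q = 3" using up down E bd nn by linarith
      moreover from this have "q \<ge> 2" using up 3 nn by linarith
      ultimately show ?thesis using down 3 nn by linarith
    next
      case 4
      then show ?thesis using up down E bd nn by linarith
    qed
    then have "m = 9" "p = 2" "q = 2" "h = 4" by auto
    then show ?thesis using bd eq b1 up down nn a1 a2 total by linarith
  next
    case 2
    have "3 * \<beta> \<le> M + r2 + p" using lin 2 by simp
    with lo 2 l have "m \<le> 13" "m \<ge> 9" using eq b1 E up h nn by linarith+
    then have "m = 9 \<and> h = 4 \<or> m = 10 \<and> h = 5 \<or> m = 11 \<and> h = 5 \<or> m = 12 \<and> h = 5 \<or> m = 13 \<and> h = 6"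
      using h by presburger
    then consider "m = 9" "h = 4" | "m = 10" "h = 5" | "m = 11" "h = 5" | "m = 12" "h = 5" | "m = 13" "h = 6"
      by blast
    then show ?thesis
    proof cases
      \<comment> \<open>The only value of \<open>m\<close> that survives for \<open>l = 3\<close>;
        the other four are contradictory.\<close>
      case 4
      have "p = 3" using lo 4 2 l by linarith
      then show ?thesis
        using 4 \<open>3 * \<beta> \<le> M + r2 + p\<close> eq b1 E up nn a1 a2 total by linarith
    qed (use \<open>3 * \<beta> \<le> M + r2 + p\<close> lo 2 l eq b1 E up nn in linarith)+
  next
    case 3
    have *: "4 * \<beta> \<le> M + r2 + p" using lin 3 by simp
    have "m \<le> 18" using lo 3 l by linarith
    moreover have "m \<ge> 16" using * eq b1 E up h nn by linarith
    ultimately have "m = 16 \<and> h = 7 \<or> m = 17 \<and> h = 7 \<or> m = 18 \<and> h = 8"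
      using h by presburger
    then consider "m = 16" "h = 7" | "m = 17" "h = 7" | "m = 18" "h = 8"
      by blast
    then show ?thesis
      by cases (use * lo 3 l eq b1 E up nn in linarith)+
  next
    case 4
    have "5 * \<beta> \<le> M + r2 + p" using lin 4 by simp
    with lo 4 l eq b1 E up h nn show ?thesis by linarith
  next
    case 5
    have "6 * \<beta> \<le> M + r2 + p" using lin 5 by simp
    with lo 5 l eq b1 E up h nn show ?thesis by linarith
  next
    case 6
    have "7 * \<beta> \<le> M + r2 + p" using lin 6 by simp
    with lo 6 l eq b1 E up h nn show ?thesis by linarith
  next
    case 7
    \<comment> \<open>From \<open>l = 8\<close> on the inequalities contradict each other for every
      \<open>m\<close>.\<close>
    have "8 * \<beta> \<le> M + r2 + p" using lin 7 by simp
    with eq b1 E up h nn show ?thesis by linarith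
  qed
qed

section \<open>Missed edges and moves of a single vertex\<close>

locale three_graph =
  fixes V :: "'a set" and E :: "'a set set"
  assumes finite_vertices: "finite V"
    and edge_subset: "e \<in> E \<Longrightarrow> e \<subseteq> V"
    and card_edge: "e \<in> E \<Longrightarrow> card e = 3"
begin

definition missed :: "'a set \<Rightarrow> nat" where
  "missed S = card {e \<in> E. e \<inter> S = {}}"

text \<open>For \<open>v\<close> in \<open>S\<close>, this is the number of edges lost by deleting
  \<open>v\<close>. Its counterpart \<open>avoiding T v\<close> is the number gained by adding
  \<open>v\<close> to \<open>T\<close>.\<close>

definition only :: "'a set \<Rightarrow> 'a \<Rightarrow> nat" where
  "only S v = card {e \<in> E. e \<inter> S = {v}}"

definition avoiding :: "'a set \<Rightarrow> 'a \<Rightarrow> nat" where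
  "avoiding T v = card {e \<in> E. v \<in> e \<and> e \<inter> T = {}}"

text \<open>The complement of meeting \<open>3m/5\<close> edges, with the denominator cleared to
  stay in the natural numbers.\<close>

definition good :: "'a set \<Rightarrow> bool" where
  "good S \<longleftrightarrow> 5 * missed S \<le> 2 * card E"

definition splits :: bool where
  "splits \<longleftrightarrow> (\<exists>P. partition_into 3 V P \<and> (\<forall>i<3. good (P i)))"

lemma finite_edges: "finite E"
  using finite_vertices edge_subset by (meson Pow_iff finite_Pow_iff finite_subset subsetI)

lemma finite_edge: "e \<in> E \<Longrightarrow> finite e"
  using card_edge card.infinite by fastforce

lemma missed_mono: "S \<subseteq> T \<Longrightarrow> missed T \<le> missed S"
  unfolding missed_def by (rule card_mono) (use finite_edges in auto)

lemma good_mono: "good S \<Longrightarrow> S \<subseteq> T \<Longrightarrow> good T"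
  using missed_mono[of S T] by (simp add: good_def)

lemma missed_remove:
  assumes "v \<in> S"
  shows "missed (S - {v}) = missed S + only S v"
proof -
  have "{e \<in> E. e \<inter> (S - {v}) = {}} = {e \<in> E. e \<inter> S = {}} \<union> {e \<in> E. e \<inter> S = {v}}"
    using assms by auto
  also have "card \<dots> = card {e \<in> E. e \<inter> S = {}} + card {e \<in> E. e \<inter> S = {v}}"
    using finite_edges by (intro card_Un_disjoint) auto
  finally show ?thesis unfolding missed_def only_def .
qed

lemma missed_insert: "missed T = missed (insert v T) + avoiding T v"
proof -
  have "{e \<in> E. e \<inter> T = {}} = {e \<in> E. e \<inter> insert v T = {}} \<union> {e \<in> E. v \<in> e \<and> e \<inter> T = {}}"
    by auto
  also have "card \<dots> =
      card {e \<in> E. e \<inter> insert v T = {}} + card {e \<in> E. v \<in> e \<and> e \<inter> T = {}}"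
    using finite_edges by (intro card_Un_disjoint) auto
  finally show ?thesis unfolding missed_def avoiding_def .
qed

lemma only_antimono: "v \<in> S \<Longrightarrow> S \<subseteq> T \<Longrightarrow> only T v \<le> only S v"
  unfolding only_def by (rule card_mono) (use finite_edges in auto)

lemma avoiding_antimono: "S \<subseteq> T \<Longrightarrow> avoiding T v \<le> avoiding S v"
  unfolding avoiding_def by (rule card_mono) (use finite_edges in auto)

section \<open>Constructing partitions and minimal good sets\<close>

lemma splitsI:
  assumes "A \<subseteq> V" "B \<subseteq> V" "C \<subseteq> V" "A \<inter> B = {}" "A \<inter> C = {}" "B \<inter> C = {}"
    and "good A" "good B" "good C"
  shows splits
proof -
  \<comment> \<open>The three sets need not cover \<open>V\<close>: leftover vertices join
    \<open>A\<close>, and enlarging a set keeps it good.\<close>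
  define P where "P i = (if i = 0 then V - B - C else if i = 1 then B else C)" for i :: nat
  have three: "{..<3::nat} = {0, 1, 2}" by auto
  have "partition_into 3 V P"
    using assms unfolding partition_into_def disjoint_family_on_def three
    by (auto simp: P_def)
  moreover have "good (V - B - C)"
    using assms by (intro good_mono[OF \<open>good A\<close>]) auto
  then have "good (P i)" if "i < 3" for i
    using assms by (simp add: P_def)
  ultimately show ?thesis unfolding splits_def by blast
qed

text \<open>Minimise the total number of missed edges. Moving \<open>v\<close> from
  \<open>P i\<close> to \<open>P j\<close> changes it by
  \<open>only (P i) v - avoiding (P j) v\<close>, which therefore is not negative.\<close>

lemma ex_locally_optimal:
  assumes "finite U" "k > 0"
  obtains P where "partition_into k U P"
    and "\<And>i j v. \<lbrakk>i < k; j < k; i \<noteq> j; v \<in> P i\<rbrakk> \<Longrightarrow> avoiding (P j) v \<le> only (P i) v"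
proof -
  let ?f = "\<lambda>P. \<Sum>i<k. missed (P i)"
  have "partition_into k U (\<lambda>i. if i = 0 then U else {})"
    using assms by (auto simp: partition_into_def disjoint_family_on_def)
  from ex_has_least_nat[of "partition_into k U", OF this, of ?f]
  obtain P where P: "partition_into k U P"
    and least: "\<And>Q. partition_into k U Q \<Longrightarrow> ?f P \<le> ?f Q" by blast
  have "avoiding (P j) v \<le> only (P i) v" if ij: "i < k" "j < k" "i \<noteq> j" and v: "v \<in> P i" for i j v
  proof -
    define Q where "Q = P(i := P i - {v}, j := insert v (P j))"
    have dis: "P a \<inter> P b = {}" if "a < k" "b < k" "a \<noteq> b" for a b
      using P that by (auto simp: partition_into_def disjoint_family_on_def)
    have "Q a \<inter> Q b = {}" if "a < k" "b < k" "a \<noteq> b" for a b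
      using dis[of a b] dis[of i a] dis[of i b] that ij v by (auto simp: Q_def)
    moreover have "(\<Union>a<k. Q a) = (\<Union>a<k. P a)"
      using ij v by (auto simp: Q_def split: if_splits)
    ultimately have "partition_into k U Q"
      using P by (auto simp: partition_into_def disjoint_family_on_def)
    from least[OF this] have "?f P \<le> ?f Q" .
    moreover have "?f R = missed (R i) + missed (R j) + (\<Sum>a\<in>{..<k} - {i, j}. missed (R a))" for R
    proof -
      have "{..<k} = insert i (insert j ({..<k} - {i, j}))" using ij by auto
      then have "?f R = sum (\<lambda>a. missed (R a)) (insert i (insert j ({..<k} - {i, j})))" by simp
      then show ?thesis using ij by simp
    qed
    moreover have "(\<Sum>a\<in>{..<k} - {i, j}. missed (Q a)) = (\<Sum>a\<in>{..<k} - {i, j}. missed (P a))"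
      by (rule sum.cong) (auto simp: Q_def)
    ultimately have "missed (P i) + missed (P j) \<le> missed (Q i) + missed (Q j)" by simp
    then show ?thesis
      using missed_remove[OF v] missed_insert[of "P j" v] ij by (simp add: Q_def)
  qed
  then show thesis using that P by blast
qed

lemma ex_minimal_good:
  assumes "finite A" "good A"
  obtains B where "B \<subseteq> A" "good B" "\<And>v. v \<in> B \<Longrightarrow> \<not> good (B - {v})"
proof -
  have "\<exists>B \<subseteq> A. good B \<and> (\<forall>v \<in> B. \<not> good (B - {v}))"
    using assms
  proof (induction A rule: finite_psubset_induct)
    case (psubset A)
    show ?case
    proof (cases "\<exists>v \<in> A. good (A - {v})")
      case True
      then obtain v where v: "v \<in> A" "good (A - {v})" by blast
      then have "A - {v} \<subset> A" by blast
      from psubset.IH[OF this v(2)] show ?thesis by blast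
    qed (use psubset.prems in blast)
  qed
  then show thesis using that by blast
qed

section \<open>Counting edges by type\<close>

text \<open>
  Every inequality below is linear in the numbers \<open>typed A B C i j k\<close> with \<open>i + j + k = 3\<close>.
\<close>
definition typed :: "'a set \<Rightarrow> 'a set \<Rightarrow> 'a set \<Rightarrow> nat \<Rightarrow> nat \<Rightarrow> nat \<Rightarrow> int" where
  "typed A B C i j k =
    int (card {e \<in> E. card (e \<inter> A) = i \<and> card (e \<inter> B) = j \<and> card (e \<inter> C) = k})"

lemma typed_nonneg: "typed A B C i j k \<ge> 0"
  by (simp add: typed_def)

definition tripartition :: "'a set \<Rightarrow> 'a set \<Rightarrow> 'a set \<Rightarrow> bool" where
  "tripartition A B C \<longleftrightarrow> A \<union> B \<union> C = V \<and> A \<inter> B = {} \<and> A \<inter> C = {} \<and> B \<inter> C = {}"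

text \<open>Every edge has exactly one of ten types. Suitable weights \<open>f\<close> turn each
  count below into a linear form in these types.\<close>

lemma sum_by_type:
  fixes f :: "nat \<Rightarrow> nat \<Rightarrow> nat \<Rightarrow> int"
  assumes "tripartition A B C"
  shows "(\<Sum>e\<in>E. f (card (e \<inter> A)) (card (e \<inter> B)) (card (e \<inter> C))) =
    f 3 0 0 * typed A B C 3 0 0 + f 2 1 0 * typed A B C 2 1 0 + f 2 0 1 * typed A B C 2 0 1 +
    f 1 2 0 * typed A B C 1 2 0 + f 1 1 1 * typed A B C 1 1 1 + f 1 0 2 * typed A B C 1 0 2 +
    f 0 3 0 * typed A B C 0 3 0 + f 0 2 1 * typed A B C 0 2 1 + f 0 1 2 * typed A B C 0 1 2 +
    f 0 0 3 * typed A B C 0 0 3"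
proof -
  let ?g = "\<lambda>i j k e. f i j k *
    of_bool (card (e \<inter> A) = i \<and> card (e \<inter> B) = j \<and> card (e \<inter> C) = k)"
  have g: "(\<Sum>e\<in>E. ?g i j k e) = f i j k * typed A B C i j k" for i j k
    using finite_edges by (simp add: typed_def sum_distrib_left[symmetric] Int_def)
  have "f (card (e \<inter> A)) (card (e \<inter> B)) (card (e \<inter> C)) =
      ?g 3 0 0 e + ?g 2 1 0 e + ?g 2 0 1 e + ?g 1 2 0 e + ?g 1 1 1 e + ?g 1 0 2 e +
      ?g 0 3 0 e + ?g 0 2 1 e + ?g 0 1 2 e + ?g 0 0 3 e" if "e \<in> E" for e
  proof -
    have "e = (e \<inter> A) \<union> (e \<inter> B) \<union> (e \<inter> C)"
      using assms edge_subset[OF that] by (auto simp: tripartition_def)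
    then have "card e = card ((e \<inter> A) \<union> (e \<inter> B) \<union> (e \<inter> C))" by simp
    also have "\<dots> = card (e \<inter> A) + card (e \<inter> B) + card (e \<inter> C)"
      using assms finite_edge[OF that]
      by (subst card_Un_disjoint; (subst card_Un_disjoint)?) (auto simp: tripartition_def)
    finally have "card (e \<inter> A) + card (e \<inter> B) + card (e \<inter> C) = 3"
      using card_edge[OF that] by simp
    from sum_eq_three_cases[OF this] show ?thesis by (elim disjE conjE) simp_all
  qed
  then have "(\<Sum>e\<in>E. f (card (e \<inter> A)) (card (e \<inter> B)) (card (e \<inter> C))) =
      (\<Sum>e\<in>E. ?g 3 0 0 e + ?g 2 1 0 e + ?g 2 0 1 e + ?g 1 2 0 e + ?g 1 1 1 e + ?g 1 0 2 e +
      ?g 0 3 0 e + ?g 0 2 1 e + ?g 0 1 2 e + ?g 0 0 3 e)"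
    by (rule sum.cong[OF refl])
  also have "\<dots> = f 3 0 0 * typed A B C 3 0 0 + f 2 1 0 * typed A B C 2 1 0 +
    f 2 0 1 * typed A B C 2 0 1 +
    f 1 2 0 * typed A B C 1 2 0 + f 1 1 1 * typed A B C 1 1 1 + f 1 0 2 * typed A B C 1 0 2 +
    f 0 3 0 * typed A B C 0 3 0 + f 0 2 1 * typed A B C 0 2 1 + f 0 1 2 * typed A B C 0 1 2 +
    f 0 0 3 * typed A B C 0 0 3"
    by (simp only: sum.distrib g)
  finally show ?thesis .
qed

lemma missed_eq_sum: "int (missed S) = (\<Sum>e\<in>E. of_bool (card (e \<inter> S) = 0))"
proof -
  have "{e \<in> E. e \<inter> S = {}} = {e \<in> E. card (e \<inter> S) = 0}"
    using finite_edge by auto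
  then show ?thesis using finite_edges by (simp add: missed_def Int_def)
qed

text \<open>Double counting: an edge is counted only if it meets \<open>S\<close> in one vertex, and
  then for that vertex alone.\<close>

lemma sum_only:
  assumes "finite S"
  shows "(\<Sum>v\<in>S. int (only S v)) = (\<Sum>e\<in>E. of_bool (card (e \<inter> S) = 1))"
proof -
  have "(\<Sum>v\<in>S. of_bool (e \<inter> S = {v})) = (of_bool (card (e \<inter> S) = 1) :: int)" for e
  proof (cases "card (e \<inter> S) = 1")
    case True
    then obtain w where w: "e \<inter> S = {w}" by (auto simp: card_1_singleton_iff)
    then have "S \<inter> {v. w = v} = {w}" by auto
    with w show ?thesis using assms by simp
  next
    case False
    then have "e \<inter> S \<noteq> {v}" for v by auto
    with False show ?thesis by simp
  qed
  then have "(\<Sum>e\<in>E. of_bool (card (e \<inter> S) = 1)) =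
      (\<Sum>e\<in>E. \<Sum>v\<in>S. (of_bool (e \<inter> S = {v}) :: int))" by simp
  also have "\<dots> = (\<Sum>v\<in>S. \<Sum>e\<in>E. of_bool (e \<inter> S = {v}))" by (rule sum.swap)
  also have "\<dots> = (\<Sum>v\<in>S. int (only S v))"
    using finite_edges by (simp add: only_def Int_def)
  finally show ?thesis by simp
qed

text \<open>Double counting: an edge disjoint from \<open>T\<close> is counted once for each of its
  vertices in \<open>S\<close>.\<close>

lemma sum_avoiding:
  assumes "finite S"
  shows "(\<Sum>v\<in>S. int (avoiding T v)) =
    (\<Sum>e\<in>E. if card (e \<inter> T) = 0 then int (card (e \<inter> S)) else 0)"
proof -
  have "(if card (e \<inter> T) = 0 then int (card (e \<inter> S)) else 0) =
      (\<Sum>v\<in>S. of_bool (v \<in> e \<and> e \<inter> T = {}))" if "e \<in> E" for e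
    using assms finite_edge[OF that] by (simp add: Int_def conj_commute)
  then have "(\<Sum>e\<in>E. if card (e \<inter> T) = 0 then int (card (e \<inter> S)) else 0) =
      (\<Sum>e\<in>E. \<Sum>v\<in>S. (of_bool (v \<in> e \<and> e \<inter> T = {}) :: int))" by simp
  also have "\<dots> = (\<Sum>v\<in>S. \<Sum>e\<in>E. of_bool (v \<in> e \<and> e \<inter> T = {}))" by (rule sum.swap)
  also have "\<dots> = (\<Sum>v\<in>S. int (avoiding T v))"
    using finite_edges by (simp add: avoiding_def Int_def)
  finally show ?thesis by simp
qed

lemma tripartition_finite:
  assumes "tripartition A B C"
  shows "finite A" "finite B" "finite C"
  using assms finite_vertices by (auto simp: tripartition_def)

lemma typed_permute:
  "typed B A C i j k = typed A B C j i k"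
  "typed A C B i j k = typed A B C i k j"
  "typed C A B i j k = typed A B C j k i"
  "typed C B A i j k = typed A B C k j i"
  by (auto simp: typed_def conj_ac)

lemma typed_eq_0:
  assumes "finite A" "card A < i"
  shows "typed A B C i j k = 0"
proof -
  have "card (e \<inter> A) \<noteq> i" for e
    using card_mono[of A "e \<inter> A"] assms by auto
  then show ?thesis by (simp add: typed_def)
qed

lemma card_edges_by_type:
  assumes "tripartition A B C"
  shows "int (card E) = typed A B C 3 0 0 + typed A B C 2 1 0 + typed A B C 2 0 1 +
    typed A B C 1 2 0 + typed A B C 1 1 1 + typed A B C 1 0 2 + typed A B C 0 3 0 +
    typed A B C 0 2 1 + typed A B C 0 1 2 + typed A B C 0 0 3"
  using sum_by_type[OF assms, of "\<lambda>_ _ _. 1"] by simp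

lemma missed_by_type:
  assumes "tripartition A B C"
  shows "int (missed A) =
    typed A B C 0 3 0 + typed A B C 0 2 1 + typed A B C 0 1 2 + typed A B C 0 0 3"
  using sum_by_type[OF assms, of "\<lambda>a _ _. of_bool (a = 0)"] by (simp add: missed_eq_sum)

lemma sum_only_by_type:
  assumes "tripartition A B C"
  shows "(\<Sum>v\<in>A. int (only A v)) = typed A B C 1 2 0 + typed A B C 1 1 1 + typed A B C 1 0 2"
  using sum_by_type[OF assms, of "\<lambda>a _ _. of_bool (a = 1)"] tripartition_finite[OF assms]
  by (simp add: sum_only)

lemma sum_avoiding_by_type:
  assumes "tripartition A B C"
  shows "(\<Sum>v\<in>A. int (avoiding C v)) =
    3 * typed A B C 3 0 0 + 2 * typed A B C 2 1 0 + typed A B C 1 2 0"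
  using sum_by_type[OF assms, of "\<lambda>a _ c. if c = 0 then int a else 0"] tripartition_finite[OF assms]
  by (simp add: sum_avoiding)

section \<open>Consequences of local optimality\<close>

lemma local_ineq:
  assumes "tripartition A B C" "\<And>v. v \<in> A \<Longrightarrow> avoiding C v \<le> only A v"
  shows "3 * typed A B C 3 0 0 + 2 * typed A B C 2 1 0 \<le> typed A B C 1 1 1 + typed A B C 1 0 2"
proof -
  have "(\<Sum>v\<in>A. int (avoiding C v)) \<le> (\<Sum>v\<in>A. int (only A v))"
    using assms(2) by (intro sum_mono) simp
  \<comment> \<open>Edges of type \<open>1 2 0\<close> occur once in both sums and cancel.\<close>
  then show ?thesis
    using sum_only_by_type[OF assms(1)] sum_avoiding_by_type[OF assms(1)] by linarith
qed

lemma splits_of_good_vertex: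
  assumes "v \<in> V" "good {v}"
  shows splits
proof -
  have half: "good T"
    if part: "tripartition {v} S T" and opt: "\<And>w. w \<in> S \<Longrightarrow> avoiding T w \<le> only S w" for S T
  proof -
    have parts: "tripartition S {v} T" "tripartition T {v} S"
      using part by (auto simp: tripartition_def)
    have "typed S {v} T i j k = 0" if "j > 1" for i j k
      using typed_eq_0[of "{v}" j S T i k] that by (simp add: typed_permute(1)[of S "{v}" T])
    \<comment> \<open>Edges missing \<open>T\<close> have type \<open>3 0 0\<close> or
      \<open>2 1 0\<close>. The local inequality, times 3/2, bounds \<open>3 * missed T\<close> by
      3/2 of the number of edges meeting \<open>T\<close>, which is more than enough.\<close>
    then show ?thesis
      using local_ineq[OF parts(1) opt] missed_by_type[OF parts(2)] card_edges_by_type[OF parts(1)]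
        typed_nonneg[of S "{v}" T 2 0 1] typed_nonneg[of S "{v}" T 0 1 2]
        typed_nonneg[of S "{v}" T 0 0 3] typed_nonneg[of S "{v}" T 1 1 1]
        typed_nonneg[of S "{v}" T 1 0 2] typed_nonneg[of S "{v}" T 2 1 0]
        typed_nonneg[of S "{v}" T 3 0 0]
      by (simp add: typed_permute(4)[of T "{v}" S] good_def)
  qed
  obtain P where P: "partition_into 2 (V - {v}) P"
    and opt: "\<And>i j w. \<lbrakk>i < 2; j < 2; i \<noteq> j; w \<in> P i\<rbrakk> \<Longrightarrow> avoiding (P j) w \<le> only (P i) w"
    using ex_locally_optimal[of "V - {v}" 2] finite_vertices by auto
  have two: "{..<2::nat} = {0, 1}" by auto
  have "P 0 \<inter> P 1 = {}" "P 0 \<union> P 1 = V - {v}"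
    using P by (auto simp: partition_into_def two disjoint_family_on_def)
  then have parts: "tripartition {v} (P 0) (P 1)" "tripartition {v} (P 1) (P 0)"
    using assms by (auto simp: tripartition_def)
  have "good (P 1)" "good (P 0)"
    using half[OF parts(1)] half[OF parts(2)] opt by auto
  then show ?thesis
    using parts assms splitsI[of "{v}" "P 0" "P 1"] by (auto simp: tripartition_def)
qed

text \<open>Adding the four local inequalities shows that \<open>B\<close> and \<open>C\<close>
  together miss at most \<open>4m/5\<close> edges, so they are not both bad.\<close>

lemma good_or_good_of_locally_optimal:
  assumes part: "tripartition A B C"
    and "\<And>v. v \<in> A \<Longrightarrow> avoiding B v \<le> only A v"
    and "\<And>v. v \<in> A \<Longrightarrow> avoiding C v \<le> only A v"
    and "\<And>v. v \<in> B \<Longrightarrow> avoiding C v \<le> only B v"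
    and "\<And>v. v \<in> C \<Longrightarrow> avoiding B v \<le> only C v"
  shows "good B \<or> good C"
proof -
  have parts: "tripartition A C B" "tripartition B A C" "tripartition C A B"
    using part by (auto simp: tripartition_def)
  note ineqs = local_ineq[OF part assms(3)] local_ineq[OF parts(1) assms(2)]
    local_ineq[OF parts(2) assms(4)] local_ineq[OF parts(3) assms(5)]
  have "5 * int (missed B) + 5 * int (missed C) \<le> 4 * int (card E)"
    using ineqs missed_by_type[OF parts(2)] missed_by_type[OF parts(3)] card_edges_by_type[OF part]
      typed_nonneg[of A B C 0 1 2] typed_nonneg[of A B C 0 2 1] typed_nonneg[of A B C 0 3 0]
      typed_nonneg[of A B C 0 0 3] typed_nonneg[of A B C 2 1 0] typed_nonneg[of A B C 2 0 1]
      typed_nonneg[of A B C 3 0 0] typed_nonneg[of A B C 1 1 1]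
    by (simp add: typed_permute(2)[of A C B] typed_permute(1)[of B A C] typed_permute(3)[of C A B])
  then show ?thesis by (auto simp: good_def)
qed

section \<open>Minimal good sets\<close>

definition threshold :: int where
  "threshold = 2 * int (card E) div 5 + 1"

lemma threshold_bounds:
  "5 * threshold \<ge> 2 * int (card E) + 1" "5 * threshold \<le> 2 * int (card E) + 5"
  unfolding threshold_def by presburger+

lemma good_iff: "good S \<longleftrightarrow> int (missed S) + 1 \<le> threshold"
  unfolding good_def threshold_def by linarith

text \<open>Deleting any \<open>v\<close> makes \<open>A\<close> bad, so \<open>only A v\<close> is
  at least the slack \<open>threshold - missed A\<close>. Sum this over \<open>A\<close>.\<close>

lemma minimal_ineq:
  assumes "tripartition A B C" "\<And>v. v \<in> A \<Longrightarrow> \<not> good (A - {v})"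
  shows "int (card A) * (threshold - int (missed A)) \<le>
    typed A B C 1 2 0 + typed A B C 1 1 1 + typed A B C 1 0 2"
proof -
  have "(\<Sum>v\<in>A. threshold - int (missed A)) \<le> (\<Sum>v\<in>A. int (only A v))"
  proof (rule sum_mono)
    fix v assume "v \<in> A"
    then show "threshold - int (missed A) \<le> int (only A v)"
      using assms(2)[of v] missed_remove[of v A] by (simp add: good_iff)
  qed
  then show ?thesis using sum_only_by_type[OF assms(1)] by simp
qed

lemma no_large_minimal_pair:
  assumes part: "tripartition A B C"
    and good: "good A" "good B" "\<not> good C"
    and card: "card A \<ge> 3" "card B \<ge> 3"
    and minimal: "\<And>v. v \<in> A \<Longrightarrow> \<not> good (A - {v})" "\<And>v. v \<in> B \<Longrightarrow> \<not> good (B - {v})"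
    and opt: "\<And>v. v \<in> A \<Longrightarrow> avoiding C v \<le> only A v" "\<And>v. v \<in> B \<Longrightarrow> avoiding C v \<le> only B v"
  shows False
proof -
  have parts: "tripartition B A C" "tripartition C A B"
    using part by (auto simp: tripartition_def)
  \<comment> \<open>The slack of a good set is positive, so its size may be lowered to 3.\<close>
  have three: "3 * (threshold - int (missed S)) \<le> int (card S) * (threshold - int (missed S))"
    if "good S" "card S \<ge> 3" for S
    using that by (intro mult_right_mono) (auto simp: good_iff)
  note perm = typed_permute(1)[of B A C] typed_permute(3)[of C A B]
  have "threshold \<le> int (missed C)" using good(3) by (simp add: good_iff)
  moreover have "3 * threshold - 3 * int (missed A) \<le>
      typed A B C 1 2 0 + typed A B C 1 1 1 + typed A B C 1 0 2"
    using three[OF good(1) card(1)] minimal_ineq[OF part] minimal(1) by fastforce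
  moreover have "3 * threshold - 3 * int (missed B) \<le>
      typed A B C 2 1 0 + typed A B C 1 1 1 + typed A B C 0 1 2"
    using three[OF good(2) card(2)] minimal_ineq[OF parts(1), unfolded perm] minimal(2) by fastforce
  moreover have "3 * typed A B C 3 0 0 + 2 * typed A B C 2 1 0 \<le>
      typed A B C 1 1 1 + typed A B C 1 0 2"
    using local_ineq[OF part] opt(1) by blast
  moreover have "3 * typed A B C 0 3 0 + 2 * typed A B C 1 2 0 \<le>
      typed A B C 1 1 1 + typed A B C 0 1 2"
    using local_ineq[OF parts(1), unfolded perm] opt(2) by blast
  \<comment> \<open>Take each local inequality twice, each minimality inequality once and the
    badness of \<open>C\<close> nine times. The sum gives
    \<open>15 * threshold \<le> 6 * card E\<close>, after dropping types \<open>2 0 1\<close> and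
    \<open>0 2 1\<close>.\<close>
  ultimately show False
    using missed_by_type[OF part] missed_by_type[OF parts(1), unfolded perm]
      missed_by_type[OF parts(2), unfolded perm]
      card_edges_by_type[OF part] threshold_bounds(1)
      typed_nonneg[of A B C 2 0 1] typed_nonneg[of A B C 0 2 1]
    by linarith
qed

text \<open>Such an edge is \<open>insert b A\<close> with \<open>b\<close> in \<open>B\<close>, and
  edges form a set, so \<open>b\<close> determines it.\<close>

lemma typed_two_one_le:
  assumes "tripartition A B C" "card A = 2"
  shows "typed A B C 2 1 0 \<le> int (card B)"
proof -
  have "finite A" "finite B" "finite C" using tripartition_finite[OF assms(1)] by auto
  have "{e \<in> E. card (e \<inter> A) = 2 \<and> card (e \<inter> B) = 1 \<and> card (e \<inter> C) = 0} \<subseteq> (\<lambda>b. insert b A) ` B"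
  proof clarify
    fix e assume e: "e \<in> E" "card (e \<inter> A) = 2" "card (e \<inter> B) = 1" "card (e \<inter> C) = 0"
    have "e \<inter> A = A" using e(2) assms(2) \<open>finite A\<close> by (intro card_subset_eq) auto
    moreover obtain b where "e \<inter> B = {b}" using e(3) by (auto simp: card_1_singleton_iff)
    moreover have "e \<inter> C = {}" using e(4) \<open>finite C\<close> by auto
    moreover have "e = (e \<inter> A) \<union> (e \<inter> B) \<union> (e \<inter> C)"
      using edge_subset[OF e(1)] assms(1) by (auto simp: tripartition_def)
    ultimately have "e = insert b A" "b \<in> B" by auto
    then show "e \<in> (\<lambda>b. insert b A) ` B" by blast
  qed
  then have "card {e \<in> E. card (e \<inter> A) = 2 \<and> card (e \<inter> B) = 1 \<and> card (e \<inter> C) = 0} \<le> card B"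
    using \<open>finite B\<close> by (rule surj_card_le[rotated])
  then show ?thesis by (simp add: typed_def)
qed

lemma splits_of_minimal_pair:
  assumes part: "tripartition A B C"
    and good: "good A" "good B" "\<not> good C"
    and card: "card A = 2" "card B \<ge> 2"
    and minimal: "\<And>v. v \<in> A \<Longrightarrow> \<not> good (A - {v})" "\<And>v. v \<in> B \<Longrightarrow> \<not> good (B - {v})"
    and opt: "\<And>v. v \<in> A \<Longrightarrow> avoiding C v \<le> only A v" "\<And>v. v \<in> B \<Longrightarrow> avoiding C v \<le> only B v"
  shows splits
proof -
  have parts: "tripartition B A C" "tripartition C A B"
    using part by (auto simp: tripartition_def)
  note fin = tripartition_finite[OF part]
  note perm = typed_permute(1)[of B A C] typed_permute(3)[of C A B]
  have AAA: "typed A B C 3 0 0 = 0" using typed_eq_0[of A 3] fin card by simp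
  have small: "typed A B C 1 2 0 \<le> 2 \<and> typed A B C 0 3 0 = 0" if "int (card B) = 2"
    using typed_two_one_le[OF parts(1)] typed_eq_0[of B 3 A C 0 0] that fin card
    by (simp add: perm)
  have tight: "typed A B C 1 1 1 + typed A B C 1 2 0 + typed A B C 1 0 2 +
      2 * typed A B C 0 3 0 + 2 * typed A B C 0 2 1 + 2 * typed A B C 0 1 2 +
      2 * typed A B C 0 0 3 = 2 * threshold \<and> typed A B C 0 1 2 + typed A B C 0 0 3 \<ge> 1"
  proof (rule minimal_pair_arith[where p = "typed A B C 2 1 0" and ?a2.0 = "typed A B C 2 0 1"
        and l = "int (card B)" and m = "int (card E)"])
    show "int (card E) = typed A B C 2 1 0 + typed A B C 1 2 0 + typed A B C 0 3 0 +
        typed A B C 1 1 1 + typed A B C 1 0 2 + typed A B C 0 1 2 + typed A B C 2 0 1 +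
        typed A B C 0 2 1 + typed A B C 0 0 3"
      using card_edges_by_type[OF part] AAA by simp
    show "threshold \<le> typed A B C 2 1 0 + typed A B C 1 2 0 + typed A B C 0 3 0"
      using good(3) missed_by_type[OF parts(2), unfolded perm] AAA by (simp add: good_iff)
    show "2 * typed A B C 2 1 0 \<le> typed A B C 1 1 1 + typed A B C 1 0 2"
      using local_ineq[OF part opt(1)] AAA by simp
    show "2 * threshold \<le> typed A B C 1 1 1 + typed A B C 1 2 0 + typed A B C 1 0 2 +
        2 * typed A B C 0 3 0 + 2 * typed A B C 0 2 1 + 2 * typed A B C 0 1 2 +
        2 * typed A B C 0 0 3"
      using minimal_ineq[OF part minimal(1)] missed_by_type[OF part] card by simp
    show "3 * typed A B C 0 3 0 + 2 * typed A B C 1 2 0 \<le> typed A B C 1 1 1 + typed A B C 0 1 2"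
      using local_ineq[OF parts(1) opt(2), unfolded perm] by simp
    have missed_B: "int (missed B) = typed A B C 2 0 1 + typed A B C 1 0 2 + typed A B C 0 0 3"
      using missed_by_type[OF parts(1), unfolded perm] AAA by simp
    then show "typed A B C 2 0 1 + typed A B C 1 0 2 + typed A B C 0 0 3 + 1 \<le> threshold"
      using good(2) by (simp add: good_iff)
    show "int (card B) * (threshold - (typed A B C 2 0 1 + typed A B C 1 0 2 + typed A B C 0 0 3))
        \<le> typed A B C 1 1 1 + typed A B C 2 1 0 + typed A B C 0 1 2"
      using minimal_ineq[OF parts(1) minimal(2), unfolded perm] missed_B by simp
  qed (use typed_nonneg threshold_bounds card small typed_two_one_le[OF part] in auto)
  obtain u v where uv: "A = {u, v}" "u \<noteq> v"
    using card(1) by (auto simp: card_2_iff)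
  have "A - {v} = {u}" "A - {u} = {v}" using uv by auto
  then have "int (missed {u}) = int (missed A) + int (only A v)"
    "int (missed {v}) = int (missed A) + int (only A u)"
    using missed_remove[of v A] missed_remove[of u A] uv by auto
  moreover have "int (only A u) + int (only A v) =
      typed A B C 1 2 0 + typed A B C 1 1 1 + typed A B C 1 0 2"
    using sum_only_by_type[OF part] uv by simp
  moreover have "threshold \<le> int (missed {u})" "threshold \<le> int (missed {v})"
    using minimal(1)[of u] minimal(1)[of v] \<open>A - {v} = {u}\<close> \<open>A - {u} = {v}\<close> uv
    by (auto simp: good_iff)
  \<comment> \<open>Both numbers are at least \<open>threshold\<close>, and by \<open>tight\<close>
    they add up to \<open>2 * threshold\<close>.\<close>
  ultimately have missed_uv: "int (missed {u}) = threshold" "int (missed {v}) = threshold"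
    using tight missed_by_type[OF part] by linarith+
  have "\<exists>e \<in> E. card (e \<inter> A) = 0 \<and> card (e \<inter> C) \<ge> 2"
  proof (rule ccontr)
    assume "\<not> ?thesis"
    then have none: "{e \<in> E. card (e \<inter> A) = 0 \<and> card (e \<inter> B) = 1 \<and> card (e \<inter> C) = 2} = {}"
      "{e \<in> E. card (e \<inter> A) = 0 \<and> card (e \<inter> B) = 0 \<and> card (e \<inter> C) = 3} = {}" by fastforce+
    have "typed A B C 0 1 2 = 0" "typed A B C 0 0 3 = 0"
      unfolding typed_def none by simp_all
    then show False using tight by simp
  qed
  then obtain e where e: "e \<in> E" "e \<inter> A = {}" "card (e \<inter> C) \<ge> 2"
    using finite_edge by fastforce
  then obtain D where "D \<subseteq> e \<inter> C" "card D = 2"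
    by (meson obtain_subset_with_card_n)
  then obtain c d where cd: "c \<in> e" "c \<in> C" "d \<in> e" "d \<in> C" "c \<noteq> d"
    by (auto simp: card_2_iff)
  \<comment> \<open>\<open>e\<close> avoids \<open>A\<close>, so adding one of its vertices to
    \<open>{w}\<close> gains at least the edge \<open>e\<close>; one edge is all that
    \<open>{w}\<close> lacks.\<close>
  have good_insert: "good {w, x}" if "w \<in> A" "int (missed {w}) = threshold" "x \<in> e" for w x
  proof -
    have "e \<in> {e \<in> E. x \<in> e \<and> e \<inter> {w} = {}}" using e that by auto
    then have "avoiding {w} x > 0"
      unfolding avoiding_def using finite_edges by (auto simp: card_gt_0_iff)
    then show ?thesis
      using missed_insert[of "{w}" x] that by (simp add: good_iff insert_commute)
  qed
  have "good {u, c}" "good {v, d}" using good_insert uv missed_uv cd by auto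
  then show splits
    using good(2) part uv cd by (intro splitsI[of "{u, c}" "{v, d}" B]) (auto simp: tripartition_def)
qed

section \<open>From two good parts to a full partition\<close>

lemma splits_of_two_good:
  assumes part: "tripartition A0 B0 C0"
    and good0: "good A0" "good B0"
    and opt0: "\<And>v. v \<in> A0 \<Longrightarrow> avoiding C0 v \<le> only A0 v" "\<And>v. v \<in> B0 \<Longrightarrow> avoiding C0 v \<le> only B0 v"
  shows splits
proof (cases "\<exists>v \<in> V. good {v}")
  case True
  then show ?thesis using splits_of_good_vertex by blast
next
  case False
  note fin = tripartition_finite[OF part]
  obtain A where A: "A \<subseteq> A0" "good A" "\<And>v. v \<in> A \<Longrightarrow> \<not> good (A - {v})"
    using ex_minimal_good[OF fin(1) good0(1)] by blast
  obtain B where B: "B \<subseteq> B0" "good B" "\<And>v. v \<in> B \<Longrightarrow> \<not> good (B - {v})"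
    using ex_minimal_good[OF fin(2) good0(2)] by blast
  define C where "C = V - A - B"
  have parts: "tripartition A B C" "tripartition B A C" and "C0 \<subseteq> C"
    using part A(1) B(1) by (auto simp: tripartition_def C_def)
  show ?thesis
  proof (cases "good C")
    case True
    then show ?thesis
      using parts(1) A B by (intro splitsI[of A B C]) (auto simp: tripartition_def)
  next
    case bad: False
    \<comment> \<open>Shrinking \<open>A0\<close> to \<open>A\<close> can only raise
      \<open>only\<close>, and enlarging \<open>C0\<close> to \<open>C\<close> can only lower
      \<open>avoiding\<close>.\<close>
    have opt: "avoiding C v \<le> only A v" if "v \<in> A" for v
      using opt0(1)[of v] avoiding_antimono[OF \<open>C0 \<subseteq> C\<close>, of v] only_antimono[OF that A(1)] that A(1)
      by force
    have opt': "avoiding C v \<le> only B v" if "v \<in> B" for v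
      using opt0(2)[of v] avoiding_antimono[OF \<open>C0 \<subseteq> C\<close>, of v] only_antimono[OF that B(1)] that B(1)
      by force
    \<comment> \<open>Single vertices are not good in this case, and a good empty set would make the
      larger set \<open>C\<close> good.\<close>
    have two: "card S \<ge> 2" if "good S" "S \<subseteq> V" for S
    proof (rule ccontr)
      assume "\<not> ?thesis"
      then have "card S = 0 \<or> card S = 1" by linarith
      moreover have "finite S" using that finite_vertices finite_subset by blast
      ultimately have "S = {} \<or> (\<exists>v. S = {v})" by (auto simp: card_1_singleton_iff)
      moreover have "\<not> good {}"
        using bad good_mono by blast
      ultimately show False using that False by auto
    qed
    have "A \<subseteq> V" "B \<subseteq> V" using parts by (auto simp: tripartition_def)
    then consider "card A = 2" "card B \<ge> 2" | "card B = 2" "card A \<ge> 2" | "card A \<ge> 3" "card B \<ge> 3"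
      using two[OF A(2)] two[OF B(2)] by linarith
    then show ?thesis
    proof cases
      case 1
      show ?thesis
        by (rule splits_of_minimal_pair[OF parts(1) A(2) B(2) bad 1 A(3) B(3) opt opt'])
    next
      case 2
      show ?thesis
        by (rule splits_of_minimal_pair[OF parts(2) B(2) A(2) bad 2 B(3) A(3) opt' opt])
    next
      case 3
      show ?thesis
        using no_large_minimal_pair[OF parts(1) A(2) B(2) bad 3 A(3) B(3) opt opt'] by blast
    qed
  qed
qed

theorem splits: splits
proof -
  obtain P where P: "partition_into 3 V P"
    and opt: "\<And>i j v. \<lbrakk>i < 3; j < 3; i \<noteq> j; v \<in> P i\<rbrakk> \<Longrightarrow> avoiding (P j) v \<le> only (P i) v"
    using ex_locally_optimal[OF finite_vertices, of 3] by auto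
  have three: "{..<3::nat} = {0, 1, 2}" by auto
  have parts: "tripartition (P 0) (P 1) (P 2)" "tripartition (P 1) (P 0) (P 2)"
    "tripartition (P 2) (P 0) (P 1)" "tripartition (P 0) (P 2) (P 1)" "tripartition (P 1) (P 2) (P 0)"
    using P by (auto simp: partition_into_def disjoint_family_on_def three tripartition_def)
  have "good (P 1) \<or> good (P 2)" "good (P 0) \<or> good (P 2)" "good (P 0) \<or> good (P 1)"
    using good_or_good_of_locally_optimal[OF parts(1)]
      good_or_good_of_locally_optimal[OF parts(2)]
      good_or_good_of_locally_optimal[OF parts(3)] opt by auto
  then consider "good (P 0)" "good (P 1)" | "good (P 0)" "good (P 2)" | "good (P 1)" "good (P 2)"
    by blast
  then show ?thesis
    \<comment> \<open>The parts are reordered so that the two good ones come first.\<close>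
    by cases (rule splits_of_two_good[OF parts(1)] splits_of_two_good[OF parts(4)]
        splits_of_two_good[OF parts(5)]; use opt in auto)+
qed

end

theorem theorem4:
  fixes V :: "'a set" and E :: "'a set set" and m :: nat
  assumes "uniform_hypergraph 3 V E"
    and "card E = m"
  shows "\<exists>P. partition_into 3 V P \<and> (\<forall>i<3. real (card (edges_met E (P i))) \<ge> 3 / 5 * real m)"
proof -
  interpret three_graph V E
    using assms(1) by unfold_locales (auto simp: uniform_hypergraph_def)
  have met: "real (card (edges_met E S)) \<ge> 3 / 5 * real m" if "good S" for S
  proof -
    have "card E = card (edges_met E S \<union> {e \<in> E. e \<inter> S = {}})"
      by (rule arg_cong[of _ _ card]) (auto simp: edges_met_def)
    also have "\<dots> = card (edges_met E S) + missed S"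
      unfolding missed_def using finite_edges by (intro card_Un_disjoint) (auto simp: edges_met_def)
    finally show ?thesis using that assms(2) by (simp add: good_def)
  qed
  from splits show ?thesis unfolding splits_def using met by blast
qed

end
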